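(* Let $((\rho^*,z^* )^\top,x_s^* )$ be any given shock steady state of the ARZ system as described in the context, let $\gamma>0$, and set $$L_i=\frac{1}{\rho_c^*-\rho_f^*}\left(-\frac{\lambda_i}{\widetilde\lambda_i}+\frac{s_i\lambda_4}{\widetilde\lambda_4}R_i\right),\qquad i=1,2,3.$$ Consider the conditions, for each $i\in\{1,2,3\}$: (i) if $L_i>0$, then $$b_i\in\left(\frac{-\gamma\exp\left(-\frac{\gamma x_s^*}{x_i\lambda_i}\right)}{3L_i\left(1-\exp\left(-\frac{\gamma x_s^*}{x_i\lambda_i}\right)\right)},\ \frac{-\gamma\exp\left(-\frac{\gamma x_s^*}{x_i\lambda_i}\right)}{3L_i}\right);$$ (ii) if $L_i<0$, then $$b_i\in\left(\frac{-\gamma\exp\left(-\frac{\gamma x_s^*}{x_i\lambda_i}\right)}{3L_i},\ \frac{-\gamma\exp\left(-\frac{\gamma x_s^*}{x_i\lambda_i}\right)}{3L_i\left(1-\exp\left(-\frac{\gamma x_s^*}{x_i\lambda_i}\right)\right)}\right);$$ and the condition that the matrix $$M=D(x_s^*,\gamma)-K^\top D(0,\gamma)K-\left(\sum_{k=1}^3\frac{2b_k}{\gamma^2(\rho_c^*-\rho_f^* )^2}\left(\frac{\lambda_k}{\widetilde\lambda_k}-\frac{s_k\lambda_4}{\widetilde\lambda_4}R_k\right)\left(\exp\left(\frac{\gamma x_s^*}{x_k\lambda_k}\right)-1\right)\right)\widetilde D(\gamma)$$ is positive definite. If $K=\mathrm{diag}(k_1,k_2,k_3)$ is diagonal, then $M=\mathrm{diag}(D_1,D_2,D_3)$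 with $$D_i=\frac{-L_i(\rho_c^*-\rho_f^* )}{b_i}-\frac{-L_i(\rho_c^*-\rho_f^* )}{b_i}\exp\left(\frac{\gamma x_s^*}{x_i\lambda_i}\right)k_i^2+\left[\sum_{k=1}^3\frac{2b_kL_k(\rho_c^*-\rho_f^* )}{\gamma^2}\left(\exp\left(\frac{\gamma x_s^*}{x_k\lambda_k}\right)-1\right)\right]L_i^2\left(\sum_{j=1}^3\exp\left(\frac{\gamma x_s^*}{x_i\lambda_i}-\frac{\gamma x_s^*}{x_j\lambda_j}\right)\right),$$ and, for $b_i$ satisfying (i)–(ii), $M$ is positive definite as soon as $k_i^2<\exp\left(-\frac{\gamma x_s^*}{x_i\lambda_i}\right)K_i$ for $i=1,2,3$, where $$K_i=1-b_iL_i\left[\sum_{k=1}^3\frac{2b_kL_k}{\gamma^2}\left(\exp\left(\frac{\gamma x_s^*}{x_k\lambda_k}\right)-1\right)\left(\sum_{j=1}^3\exp\left(\frac{\gamma x_s^*}{x_i\lambda_i}-\frac{\gamma x_s^*}{x_j\lambda_j}\right)\right)\right].$$ In the limit case $b_i=\frac{-\gamma\exp(-\gamma x_s^*/(x_i\lambda_i))}{3L_i}$, $i=1,2,3$, one has $K_i>0$. Consequently there exist $k_1,k_2,k_3$ and $b_1,b_2,b_3$, given through the context's definitions of $K$ and $(b_1,b_2,b_3)$ by a map $G\in C^2(\mathbb{R}^4;\mathbb{R}^3)$ with $G(\mathbf 0)=\mathbf 0$, such that (i)–(ii) hold and $M$ is positive definite.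
   Context: Let $L>0$ and let $p\in C^2([0,+\infty);[0,+\infty))$ satisfy $p(0)=0$, $p'(\rho)>0$, and $\rho\mapsto\rho p(\rho)$ strictly convex. A shock steady state consists of $x_s^*\in(0,L)$ and positive constants $\rho_f^*,\rho_c^*,z_f^*,z_c^*$ (values of density and generalized momentum on $[0,x_s^* )$ and on $(x_s^*,L]$) with $z_f^*\rho_c^*=z_c^*\rho_f^*$ and $z_f^*-\rho_f^*p(\rho_f^* )=z_c^*-\rho_c^*p(\rho_c^* )$, and such that the following four numbers are positive: $$\lambda_1=\tfrac{z_f^*}{\rho_f^*}-p(\rho_f^* )-\rho_f^*p'(\rho_f^* ),\quad \lambda_2=\tfrac{z_f^*}{\rho_f^*}-p(\rho_f^* ),$$ $$\lambda_3=-\tfrac{z_c^*}{\rho_c^*}+p(\rho_c^* )+\rho_c^*p'(\rho_c^* ),\quad \lambda_4=\tfrac{z_c^*}{\rho_c^*}-p(\rho_c^* ).$$ These conditions imply $\rho_f^*<\rho_c^*$. **Notation.** $s_1=s_2=s_4=1$, $s_3=-1$; $x_1=x_2=1$, $x_3=\frac{x_s^*}{L-x_s^*}$; $(\rho^*_{(i)},z^*_{(i)})=(\rho_f^*,z_f^* )$ for $i=1,2$ and $(\rho_c^*,z_c^* )$ for $i=3,4$; $$\widetilde\lambda_i=s_i\lambda_i+p(\rho^*_{(i)})+\rho^*_{(i)}p'(\rho^*_{(i)}),\ i=1,2,3,4,\qquad R_i=\frac{\rho^*_{(5-i)}-z^*_{(5-i)}/\widetilde\lambda_i}{\rho_f^*-z_f^*/\widetilde\lambda_4},\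 i=1,2,3.$$ $$K_1=\begin{pmatrix}\frac{\widetilde\lambda_1\widetilde\lambda_2}{\widetilde\lambda_2-\widetilde\lambda_1}&\frac{-\widetilde\lambda_1}{\widetilde\lambda_2-\widetilde\lambda_1}&0\\ \frac{-\widetilde\lambda_1\widetilde\lambda_2}{\widetilde\lambda_2-\widetilde\lambda_1}&\frac{\widetilde\lambda_2}{\widetilde\lambda_2-\widetilde\lambda_1}&0\\0&0&\frac{\widetilde\lambda_3}{\widetilde\lambda_3+\widetilde\lambda_4}\end{pmatrix},$$ $$K=K_1G'(\mathbf 0)\begin{pmatrix}1&1&0\\ \frac{\rho_c^*-z_c^*/\widetilde\lambda_1}{\rho_f^*-z_f^*/\widetilde\lambda_4}&\frac{\rho_c^*-z_c^*/\widetilde\lambda_2}{\rho_f^*-z_f^*/\widetilde\lambda_4}&-\frac{z_f^*/\widetilde\lambda_3+z_f^*/\widetilde\lambda_4}{\rho_f^*-z_f^*/\widetilde\lambda_4}\\ \frac1{\widetilde\lambda_1}&\frac1{\widetilde\lambda_2}&0\\0&0&0\end{pmatrix},\qquad (b_1,b_2,b_3)^\top=K_1G'(\mathbf 0)(0,0,0,1)^\top,$$ where $G'(\mathbf 0)$ is the $3\times4$ Jacobian matrix of $G$ at the origin ($G$ is the boundary feedback map of the closed-loop ARZ system). Finally $$D(x,\gamma)=\mathrm{diag}\left(\frac1{b_i}\left(\frac{\lambda_i}{\widetilde\lambda_i}-\frac{s_i\lambda_4}{\widetilde\lambda_4}R_i\right)\exp\left(\frac{\gamma(x_s^*-x)}{x_i\lambda_i}\right)\right)_{i\in\{1,2,3\}},$$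 $$\widetilde D(\mu)=\mathrm{diag}\left(\left(\sum_{j=1}^3\exp\left(\frac{\mu x_s^*}{x_i\lambda_i}-\frac{\mu x_s^*}{x_j\lambda_j}\right)\right)\left(\frac{\lambda_i}{\widetilde\lambda_i}-\frac{s_i\lambda_4}{\widetilde\lambda_4}R_i\right)^2\right)_{i\in\{1,2,3\}}.$$
   Formalization: The positive-definiteness, limit-case and existence claims are stated for L_i ≠ 0 (i=1,2,3); if L_2 = 0 (e.g. p = arctan, ρ_f* = 1/2, ρ_c* = 2), then D_2 = 0 for every diagonal K, so M is never positive definite and the limit b_2 is undefined. *)

theory Defs
  imports "HOL-Analysis.Analysis"
begin

subsection \<open>General notions\<close>

text \<open>On a set such as \<open>{0..}\<close> the derivatives are taken relative to the set, i.e. one-sided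
  at the end point.\<close>

definition C2_on :: "'a::real_normed_vector set \<Rightarrow> ('a \<Rightarrow> 'b::real_normed_vector) \<Rightarrow> bool" where
  "C2_on S f \<longleftrightarrow>
     (\<exists>(f' :: 'a \<Rightarrow> 'a \<Rightarrow>\<^sub>L 'b) (f'' :: 'a \<Rightarrow> 'a \<Rightarrow>\<^sub>L ('a \<Rightarrow>\<^sub>L 'b)).
        (\<forall>x\<in>S. (f has_derivative blinfun_apply (f' x)) (at x within S)) \<and>
        (\<forall>x\<in>S. (f' has_derivative blinfun_apply (f'' x)) (at x within S)) \<and>
        continuous_on S f'')"

definition strictly_convex_on :: "'a::real_vector set \<Rightarrow> ('a \<Rightarrow> real) \<Rightarrow> bool" where
  "strictly_convex_on S f \<longleftrightarrow>
     convex S \<and>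
     (\<forall>x\<in>S. \<forall>y\<in>S. \<forall>t\<in>{0<..<1}. x \<noteq> y \<longrightarrow>
        f ((1 - t) *\<^sub>R x + t *\<^sub>R y) < (1 - t) * f x + t * f y)"

definition positive_definite :: "real^'n^'n \<Rightarrow> bool" where
  "positive_definite A \<longleftrightarrow> transpose A = A \<and> (\<forall>x. x \<noteq> 0 \<longrightarrow> x \<bullet> (A *v x) > 0)"

text \<open>Scalar families are functions on \<open>nat\<close>, used only at the indices 1, 2, 3 (and 4 where it
  makes sense), because the formulas mix the index ranges 1..3 and 1..4 and use \<open>5 - i\<close>.\<close>

definition diag3 :: "(nat \<Rightarrow> real) \<Rightarrow> real^3^3" where
  "diag3 d = vector [vector [d 1, 0, 0], vector [0, d 2, 0], vector [0, 0, d 3]]"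


subsection \<open>Shock steady states\<close>

record shock_data =
  press :: "real \<Rightarrow> real"    \<comment> \<open>\<open>p\<close>; only its values on \<open>{0..}\<close> matter\<close>
  road :: real               \<comment> \<open>\<open>L\<close>\<close>
  xs :: real
  rho_f :: real
  rho_c :: real
  z_f :: real
  z_c :: real

definition pressure_law :: "(real \<Rightarrow> real) \<Rightarrow> bool" where
  "pressure_law p \<longleftrightarrow>
     C2_on {0..} p \<and> (\<forall>\<rho>\<ge>0. p \<rho> \<ge> 0) \<and> p 0 = 0 \<and>
     (\<forall>\<rho>>0. deriv p \<rho> > 0) \<and> strictly_convex_on {0..} (\<lambda>\<rho>. \<rho> * p \<rho>)"

definition rho_at :: "shock_data \<Rightarrow> nat \<Rightarrow> real" where
  "rho_at S i = (if i = 1 \<or> i = 2 then rho_f S else rho_c S)"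

definition z_at :: "shock_data \<Rightarrow> nat \<Rightarrow> real" where
  "z_at S i = (if i = 1 \<or> i = 2 then z_f S else z_c S)"

definition sg :: "nat \<Rightarrow> real" where
  "sg i = (if i = 3 then -1 else 1)"

definition xw :: "shock_data \<Rightarrow> nat \<Rightarrow> real" where
  "xw S i = (if i = 3 then xs S / (road S - xs S) else 1)"

definition lam :: "shock_data \<Rightarrow> nat \<Rightarrow> real" where
  "lam S i =
     (if i = 1 then z_f S / rho_f S - press S (rho_f S) - rho_f S * deriv (press S) (rho_f S)
      else if i = 2 then z_f S / rho_f S - press S (rho_f S)
      else if i = 3 then - (z_c S / rho_c S) + press S (rho_c S) + rho_c S * deriv (press S) (rho_c S)
      else z_c S / rho_c S - press S (rho_c S))"

definition shock_steady_state :: "shock_data \<Rightarrow> bool" where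
  "shock_steady_state S \<longleftrightarrow>
     road S > 0 \<and> pressure_law (press S) \<and> xs S \<in> {0<..<road S} \<and>
     rho_f S > 0 \<and> rho_c S > 0 \<and> z_f S > 0 \<and> z_c S > 0 \<and>
     z_f S * rho_c S = z_c S * rho_f S \<and>
     z_f S - rho_f S * press S (rho_f S) = z_c S - rho_c S * press S (rho_c S) \<and>
     (\<forall>i\<in>{1..4}. lam S i > 0)"

definition tlam :: "shock_data \<Rightarrow> nat \<Rightarrow> real" where
  "tlam S i = sg i * lam S i + press S (rho_at S i) + rho_at S i * deriv (press S) (rho_at S i)"

definition R :: "shock_data \<Rightarrow> nat \<Rightarrow> real" where
  "R S i = (rho_at S (5 - i) - z_at S (5 - i) / tlam S i) / (rho_f S - z_f S / tlam S 4)"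


subsection \<open>The matrices of the closed-loop system\<close>

definition K1 :: "shock_data \<Rightarrow> real^3^3" where
  "K1 S = vector
     [vector [tlam S 1 * tlam S 2 / (tlam S 2 - tlam S 1), - tlam S 1 / (tlam S 2 - tlam S 1), 0],
      vector [- tlam S 1 * tlam S 2 / (tlam S 2 - tlam S 1), tlam S 2 / (tlam S 2 - tlam S 1), 0],
      vector [0, 0, tlam S 3 / (tlam S 3 + tlam S 4)]]"

definition K2 :: "shock_data \<Rightarrow> real^3^4" where
  "K2 S = vector
     [vector [1, 1, 0],
      vector [(rho_c S - z_c S / tlam S 1) / (rho_f S - z_f S / tlam S 4),
              (rho_c S - z_c S / tlam S 2) / (rho_f S - z_f S / tlam S 4),
              - ((z_f S / tlam S 3 + z_f S / tlam S 4) / (rho_f S - z_f S / tlam S 4))],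
      vector [1 / tlam S 1, 1 / tlam S 2, 0],
      vector [0, 0, 0]]"

definition Kmat :: "shock_data \<Rightarrow> (real^4 \<Rightarrow> real^3) \<Rightarrow> real^3^3" where
  "Kmat S G = K1 S ** jacobian G (at 0) ** K2 S"

definition bvec :: "shock_data \<Rightarrow> (real^4 \<Rightarrow> real^3) \<Rightarrow> nat \<Rightarrow> real" where
  "bvec S G i = (K1 S *v (jacobian G (at 0) *v vector [0, 0, 0, 1])) $ of_nat i"

definition Dmat :: "shock_data \<Rightarrow> (nat \<Rightarrow> real) \<Rightarrow> real \<Rightarrow> real \<Rightarrow> real^3^3" where
  "Dmat S b x \<gamma> = diag3 (\<lambda>i.
     1 / b i * (lam S i / tlam S i - sg i * lam S 4 / tlam S 4 * R S i) *
     exp (\<gamma> * (xs S - x) / (xw S i * lam S i)))"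

definition Dtilde :: "shock_data \<Rightarrow> real \<Rightarrow> real^3^3" where
  "Dtilde S \<mu> = diag3 (\<lambda>i.
     (\<Sum>j\<in>{1..3}. exp (\<mu> * xs S / (xw S i * lam S i) - \<mu> * xs S / (xw S j * lam S j))) *
     (lam S i / tlam S i - sg i * lam S 4 / tlam S 4 * R S i)\<^sup>2)"

definition Mmat :: "shock_data \<Rightarrow> real \<Rightarrow> (nat \<Rightarrow> real) \<Rightarrow> real^3^3 \<Rightarrow> real^3^3" where
  "Mmat S \<gamma> b K =
     Dmat S b (xs S) \<gamma> - transpose K ** Dmat S b 0 \<gamma> ** K -
     (\<Sum>k\<in>{1..3}. 2 * b k / (\<gamma>\<^sup>2 * (rho_c S - rho_f S)\<^sup>2) *
        (lam S k / tlam S k - sg k * lam S 4 / tlam S 4 * R S k) *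
        (exp (\<gamma> * xs S / (xw S k * lam S k)) - 1)) *\<^sub>R Dtilde S \<gamma>"


subsection \<open>The conditions on the feedback parameters\<close>

text \<open>\<open>Lc S 1\<close> and \<open>Lc S 3\<close> are negative for every shock steady state, but \<open>Lc S 2\<close> vanishes
  exactly when \<open>\<rho> * p' \<rho>\<close> takes the same value at \<open>rho_f\<close> and \<open>rho_c\<close>. This can happen:
  take \<open>p = arctan\<close>, \<open>rho_f = 1/2\<close>, \<open>rho_c = 2\<close>. In that case the second diagonal entry of
  \<open>Mmat\<close> is zero for diagonal \<open>K\<close>.\<close>

definition Lc :: "shock_data \<Rightarrow> nat \<Rightarrow> real" where
  "Lc S i = 1 / (rho_c S - rho_f S) *
     (- (lam S i / tlam S i) + sg i * lam S 4 / tlam S 4 * R S i)"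

definition b_condition :: "shock_data \<Rightarrow> real \<Rightarrow> (nat \<Rightarrow> real) \<Rightarrow> nat \<Rightarrow> bool" where
  "b_condition S \<gamma> b i \<longleftrightarrow>
     (Lc S i > 0 \<longrightarrow>
        b i \<in> {- \<gamma> * exp (- (\<gamma> * xs S / (xw S i * lam S i))) /
                 (3 * Lc S i * (1 - exp (- (\<gamma> * xs S / (xw S i * lam S i)))))
               <..<
               - \<gamma> * exp (- (\<gamma> * xs S / (xw S i * lam S i))) / (3 * Lc S i)}) \<and>
     (Lc S i < 0 \<longrightarrow>
        b i \<in> {- \<gamma> * exp (- (\<gamma> * xs S / (xw S i * lam S i))) / (3 * Lc S i)
               <..<
               - \<gamma> * exp (- (\<gamma> * xs S / (xw S i * lam S i))) /
                 (3 * Lc S i * (1 - exp (- (\<gamma> * xs S / (xw S i * lam S i)))))})"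

definition Dentry :: "shock_data \<Rightarrow> real \<Rightarrow> (nat \<Rightarrow> real) \<Rightarrow> (nat \<Rightarrow> real) \<Rightarrow> nat \<Rightarrow> real" where
  "Dentry S \<gamma> b k i =
     - Lc S i * (rho_c S - rho_f S) / b i
     - - Lc S i * (rho_c S - rho_f S) / b i * exp (\<gamma> * xs S / (xw S i * lam S i)) * (k i)\<^sup>2
     + (\<Sum>l\<in>{1..3}. 2 * b l * Lc S l * (rho_c S - rho_f S) / \<gamma>\<^sup>2 *
          (exp (\<gamma> * xs S / (xw S l * lam S l)) - 1)) *
       (Lc S i)\<^sup>2 *
       (\<Sum>j\<in>{1..3}. exp (\<gamma> * xs S / (xw S i * lam S i) - \<gamma> * xs S / (xw S j * lam S j)))"

definition Kbound :: "shock_data \<Rightarrow> real \<Rightarrow> (nat \<Rightarrow> real) \<Rightarrow> nat \<Rightarrow> real" where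
  "Kbound S \<gamma> b i = 1 - b i * Lc S i *
     (\<Sum>l\<in>{1..3}. 2 * b l * Lc S l / \<gamma>\<^sup>2 * (exp (\<gamma> * xs S / (xw S l * lam S l)) - 1) *
       (\<Sum>j\<in>{1..3}. exp (\<gamma> * xs S / (xw S i * lam S i) - \<gamma> * xs S / (xw S j * lam S j))))"

end

theory Submission
  imports Defs
begin

text \<open>
  Write \<open>\<Delta> = rho_c - rho_f\<close>, \<open>w i = \<gamma> xs / (xw i lam i)\<close> and \<open>e i = exp (- w i)\<close>. Every
  factor \<open>lam i / tlam i - sg i lam 4 / tlam 4 R i\<close> in \<open>Mmat\<close> equals \<open>- Lc i * \<Delta>\<close>, so for a diagonal
  \<open>K\<close> the matrix is diagonal and, where \<open>b i \<noteq> 0\<close>, its entries factor as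
  \<open>- Lc i * \<Delta> / b i * (Kbound i - exp (w i) * (k i)^2)\<close> (lemmas \<open>Mmat_diag3\<close> and
  \<open>Dentry_eq_Kbound\<close>). For \<open>Lc i \<noteq> 0\<close> the interval conditions
  force \<open>b i\<close> and \<open>Lc i\<close> to have opposite signs. Moreover
  \<open>\<Delta> > 0\<close>: since \<open>z / rho\<close> agrees on the two sides, \<open>lam 1 + lam 3 > 0\<close> says that the derivative
  of the convex function \<open>\<rho> * p \<rho>\<close> is larger at \<open>rho_c\<close> than at \<open>rho_f\<close>. Hence the first factor
  is positive, and the bound on \<open>(k i)^2\<close> is exactly positivity of the second.

  If \<open>b\<close> is \<open>t\<close> times the limit value \<open>- \<gamma> * e i / (3 * Lc i)\<close>, then each
  \<open>b i * Lc i = - t * \<gamma> * e i / 3\<close>, the \<open>Lc i\<close> drop out, and \<open>Kbound i\<close> becomes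
  \<open>1 - t^2 * (2/9) * (3 - s) * s\<close> with \<open>s = e 1 + e 2 + e 3\<close>, independently of \<open>i\<close>. As
  \<open>(3 - s) * s \<le> 9/4\<close>, this is at least \<open>1 - t^2 / 2\<close>, positive for \<open>t = 1\<close> and still for
  \<open>t\<close> slightly above 1, where \<open>b\<close> lies inside the open intervals.

  For existence one takes \<open>K = 0\<close>, with \<open>G\<close> linear and depending on its fourth argument only: then
  its Jacobian times \<open>K2\<close> is zero, while invertibility of \<open>K1\<close> leaves \<open>b\<close> at free choice
  (\<open>feedback_realisation\<close>).
\<close>

section \<open>The direction of the density jump\<close>

lemma pressure_law_flux_derivative:
  assumes "pressure_law p" "\<rho> > 0"
  shows "((\<lambda>r. r * p r) has_real_derivative p \<rho> + \<rho> * deriv p \<rho>) (at \<rho>)"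
proof -
  obtain p' :: "real \<Rightarrow> real \<Rightarrow>\<^sub>L real"
    where "(p has_derivative blinfun_apply (p' \<rho>)) (at \<rho> within {0..})"
    using assms unfolding pressure_law_def C2_on_def by force
  moreover have "at \<rho> within {0..} = at \<rho>"
    using assms(2) by (intro at_within_interior) simp
  ultimately have "p differentiable at \<rho>"
    unfolding differentiable_def by auto
  then have "(p has_real_derivative deriv p \<rho>) (at \<rho>)"
    using DERIV_deriv_iff_real_differentiable by blast
  then show ?thesis
    by (auto intro!: derivative_eq_intros)
qed

lemma strictly_convex_on_imp_convex_on:
  assumes "strictly_convex_on A f"
  shows "convex_on A f"
proof (rule convex_onI)
  show "convex A" using assms by (simp add: strictly_convex_on_def)
next
  fix t :: real and x y assume "0 < t" "t < 1" "x \<in> A" "y \<in> A"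
  then show "f ((1 - t) *\<^sub>R x + t *\<^sub>R y) \<le> (1 - t) * f x + t * f y"
    using assms unfolding strictly_convex_on_def
    by (cases "x = y") (auto simp: algebra_simps less_imp_le simp flip: scaleR_add_left)
qed

text \<open>Adding the two tangent inequalities, at \<open>x\<close> evaluated in \<open>y\<close> and conversely, gives
  \<open>(d - c) * (x - y) \<le> 0\<close>.\<close>

lemma convex_on_less_from_derivatives:
  fixes f :: "real \<Rightarrow> real"
  assumes "convex_on {0..} f" "x > 0" "y > 0"
    and "(f has_real_derivative c) (at x)" "(f has_real_derivative d) (at y)" "c < d"
  shows "x < y"
proof (rule ccontr)
  assume "\<not> x < y"
  have tangent: "f b - f a \<ge> m * (b - a)"
    if "a > 0" "b > 0" "(f has_real_derivative m) (at a)" for a b m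
    using that assms(1)
    by (intro convex_on_imp_above_tangent[of "{0..}"])
       (auto intro: has_field_derivative_at_within)
  have "(d - c) * (x - y) \<le> 0"
    using tangent[of x y c] tangent[of y x d] assms by (simp add: algebra_simps)
  moreover have "x \<noteq> y"
    using assms(4-6) DERIV_unique by fastforce
  ultimately show False
    using \<open>c < d\<close> \<open>\<not> x < y\<close> by (simp add: mult_le_0_iff)
qed

lemma shock_rho_less:
  assumes "shock_steady_state S"
  shows "rho_f S < rho_c S"
proof -
  have pos: "rho_f S > 0" "rho_c S > 0" "pressure_law (press S)"
    and "z_f S * rho_c S = z_c S * rho_f S" and "lam S 1 > 0" "lam S 3 > 0"
    using assms by (auto simp: shock_steady_state_def)
  then have "z_f S / rho_f S = z_c S / rho_c S"
    by (simp add: field_simps)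
  \<comment> \<open>rearranged from \<open>lam S 1 + lam S 3 > 0\<close>\<close>
  then have "press S (rho_f S) + rho_f S * deriv (press S) (rho_f S)
      < press S (rho_c S) + rho_c S * deriv (press S) (rho_c S)"
    using \<open>lam S 1 > 0\<close> \<open>lam S 3 > 0\<close> by (simp add: lam_def)
  moreover have "convex_on {0..} (\<lambda>\<rho>. \<rho> * press S \<rho>)"
    using pos(3) by (simp add: pressure_law_def strictly_convex_on_imp_convex_on)
  ultimately show ?thesis
    using convex_on_less_from_derivatives[OF _ pos(1,2)
        pressure_law_flux_derivative[OF pos(3,1)] pressure_law_flux_derivative[OF pos(3,2)]]
    by blast
qed

section \<open>Diagonal matrices of order three\<close>

lemma ball_1_3: "(\<forall>i\<in>{1..3::nat}. P i) \<longleftrightarrow> P 1 \<and> P 2 \<and> P 3"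
proof -
  have "{1..3::nat} = {1, 2, 3}" by auto
  then show ?thesis by simp
qed

lemmas mat3_simps = vec_eq_iff forall_3 vector_def diag3_def matrix_matrix_mult_def
  matrix_vector_mult_def transpose_def sum_3

lemma diag3_congruence:
  "transpose (diag3 k) ** diag3 d ** diag3 k = diag3 (\<lambda>i. d i * (k i)\<^sup>2)"
  by (simp add: mat3_simps power2_eq_square)

lemma diag3_minus: "diag3 d - diag3 e = diag3 (\<lambda>i. d i - e i)"
  by (simp add: mat3_simps)

lemma diag3_scaleR: "c *\<^sub>R diag3 d = diag3 (\<lambda>i. c * d i)"
  by (simp add: mat3_simps)

lemma diag3_cong: "(\<And>i. i \<in> {1..3} \<Longrightarrow> d i = e i) \<Longrightarrow> diag3 d = diag3 e"
  by (simp add: diag3_def)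

lemma positive_definite_diag3:
  assumes "\<forall>i\<in>{1..3}. d i > 0"
  shows "positive_definite (diag3 d)"
proof -
  have "x \<bullet> (diag3 d *v x) > 0" if "x \<noteq> 0" for x :: "real^3"
  proof -
    have d: "d 1 > 0" "d 2 > 0" "d 3 > 0"
      using assms by auto
    have "x $ 1 \<noteq> 0 \<or> x $ 2 \<noteq> 0 \<or> x $ 3 \<noteq> 0"
      using that by (auto simp: vec_eq_iff forall_3)
    moreover have "x \<bullet> (diag3 d *v x) = d 1 * (x $ 1)\<^sup>2 + d 2 * (x $ 2)\<^sup>2 + d 3 * (x $ 3)\<^sup>2"
      by (simp add: inner_vec_def mat3_simps power2_eq_square algebra_simps)
    moreover have "d 1 * (x $ 1)\<^sup>2 \<ge> 0" "d 2 * (x $ 2)\<^sup>2 \<ge> 0" "d 3 * (x $ 3)\<^sup>2 \<ge> 0"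
      using d by simp_all
    moreover have "a \<noteq> 0 \<Longrightarrow> c > 0 \<Longrightarrow> c * a\<^sup>2 > 0" for a c :: real
      by simp
    ultimately show ?thesis
      using d by (smt (verit))
  qed
  moreover have "transpose (diag3 d) = diag3 d"
    by (simp add: mat3_simps)
  ultimately show ?thesis
    by (simp add: positive_definite_def)
qed

section \<open>The matrix of the stability condition for a diagonal feedback\<close>

text \<open>The exponent common to all the matrices; \<open>xw S i * lam S i\<close> is the speed of the \<open>i\<close>th
  characteristic once both road sections are rescaled to \<open>{0..xs S}\<close>.\<close>

definition travel_weight :: "shock_data \<Rightarrow> real \<Rightarrow> nat \<Rightarrow> real" where
  "travel_weight S \<gamma> i = \<gamma> * xs S / (xw S i * lam S i)"

lemma travel_weight_pos:
  assumes "shock_steady_state S" "\<gamma> > 0" "i \<in> {1..3}"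
  shows "travel_weight S \<gamma> i > 0"
proof -
  have "lam S i > 0" "xs S > 0" "road S - xs S > 0"
    using assms(1,3) by (auto simp: shock_steady_state_def)
  then show ?thesis
    using assms(2) by (simp add: travel_weight_def xw_def)
qed

lemma gain_eq_Lc:
  assumes "rho_f S < rho_c S"
  shows "lam S i / tlam S i - sg i * lam S 4 / tlam S 4 * R S i = - Lc S i * (rho_c S - rho_f S)"
  unfolding Lc_def minus_mult_left[symmetric] using assms by simp

lemma Mmat_diag3:
  assumes "rho_f S < rho_c S"
  shows "Mmat S \<gamma> b (diag3 k) = diag3 (Dentry S \<gamma> b k)"
proof -
  let ?\<Delta> = "rho_c S - rho_f S"
  let ?w = "travel_weight S \<gamma>"
  have \<Delta>: "?\<Delta> \<noteq> 0" using assms by simp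
  have summand: "2 * b l / (\<gamma>\<^sup>2 * ?\<Delta>\<^sup>2) * (- Lc S l * ?\<Delta>) * (exp (?w l) - 1)
      = - (2 * b l * Lc S l * ?\<Delta> / \<gamma>\<^sup>2 * (exp (?w l) - 1)) / ?\<Delta>\<^sup>2" for l
    by simp
  have "Mmat S \<gamma> b (diag3 k) = diag3 (\<lambda>i. 1 / b i * (- Lc S i * ?\<Delta>)
      - 1 / b i * (- Lc S i * ?\<Delta>) * exp (?w i) * (k i)\<^sup>2
      - (\<Sum>l\<in>{1..3}. - (2 * b l * Lc S l * ?\<Delta> / \<gamma>\<^sup>2 * (exp (?w l) - 1)) / ?\<Delta>\<^sup>2)
        * ((\<Sum>j\<in>{1..3}. exp (?w i - ?w j)) * (- Lc S i * ?\<Delta>)\<^sup>2))"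
    unfolding Mmat_def Dmat_def Dtilde_def gain_eq_Lc[OF assms] diag3_congruence diag3_minus
      diag3_scaleR travel_weight_def summand[unfolded travel_weight_def]
    by simp
  also have "\<dots> = diag3 (Dentry S \<gamma> b k)"
  proof (rule diag3_cong)
    fix i
    have "- (\<Sum>l\<in>{1..3}. - (2 * b l * Lc S l * ?\<Delta> / \<gamma>\<^sup>2 * (exp (?w l) - 1)) / ?\<Delta>\<^sup>2)
        * (X * (- Lc S i * ?\<Delta>)\<^sup>2)
      = (\<Sum>l\<in>{1..3}. 2 * b l * Lc S l * ?\<Delta> / \<gamma>\<^sup>2 * (exp (?w l) - 1)) * (Lc S i)\<^sup>2 * X" for X
      unfolding sum_divide_distrib[symmetric] sum_negf using \<Delta>
      by (simp add: power_mult_distrib)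
    then show "1 / b i * (- Lc S i * ?\<Delta>) - 1 / b i * (- Lc S i * ?\<Delta>) * exp (?w i) * (k i)\<^sup>2
      - (\<Sum>l\<in>{1..3}. - (2 * b l * Lc S l * ?\<Delta> / \<gamma>\<^sup>2 * (exp (?w l) - 1)) / ?\<Delta>\<^sup>2)
        * ((\<Sum>j\<in>{1..3}. exp (?w i - ?w j)) * (- Lc S i * ?\<Delta>)\<^sup>2) = Dentry S \<gamma> b k i"
      unfolding Dentry_def travel_weight_def by simp
  qed
  finally show ?thesis .
qed

lemma Dentry_eq_Kbound:
  assumes "b i \<noteq> 0"
  shows "Dentry S \<gamma> b k i = - Lc S i * (rho_c S - rho_f S) / b i
    * (Kbound S \<gamma> b i - exp (travel_weight S \<gamma> i) * (k i)\<^sup>2)"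
proof -
  let ?\<Delta> = "rho_c S - rho_f S"
  let ?g = "\<lambda>l. 2 * b l * Lc S l / \<gamma>\<^sup>2 * (exp (travel_weight S \<gamma> l) - 1)"
  let ?Y = "\<Sum>j\<in>{1..3}. exp (travel_weight S \<gamma> i - travel_weight S \<gamma> j)"
  have pull_\<Delta>: "(\<Sum>l\<in>{1..3}. 2 * b l * Lc S l * ?\<Delta> / \<gamma>\<^sup>2 * (exp (travel_weight S \<gamma> l) - 1))
      = ?\<Delta> * sum ?g {1..3}"
    unfolding sum_distrib_left by (intro sum.cong) simp_all
  have pull_Y: "(\<Sum>l\<in>{1..3}. ?g l * ?Y) = sum ?g {1..3} * ?Y"
    unfolding sum_distrib_right ..
  have factor: "- L * \<Delta> / b i - - L * \<Delta> / b i * E * q + \<Delta> * H * L\<^sup>2 * Y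
      = - L * \<Delta> / b i * (1 - b i * L * (H * Y) - E * q)" for L \<Delta> E q H Y
    using assms by (simp add: right_diff_distrib power2_eq_square)
  show ?thesis
    unfolding Dentry_def Kbound_def travel_weight_def[symmetric] pull_\<Delta> pull_Y by (rule factor)
qed

lemma b_condition_imp_opposite_sign:
  assumes "b_condition S \<gamma> b i" "Lc S i \<noteq> 0" "\<gamma> > 0"
  shows "b i * Lc S i < 0"
proof -
  let ?c = "- \<gamma> * exp (- (\<gamma> * xs S / (xw S i * lam S i))) / (3 * Lc S i)"
  consider "Lc S i > 0" "b i < ?c" | "Lc S i < 0" "?c < b i"
    using assms(1,2) by (fastforce simp: b_condition_def)
  then show ?thesis
  proof cases
    case 1
    moreover have "?c < 0" using 1 assms(3) by simp
    ultimately show ?thesis by (simp add: mult_less_0_iff)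
  next
    case 2
    moreover have "?c > 0" using 2 assms(3) by (intro divide_neg_neg) simp_all
    ultimately show ?thesis by (simp add: mult_less_0_iff)
  qed
qed

lemma Mmat_positive_definite:
  assumes "rho_f S < rho_c S" "\<gamma> > 0"
    and "\<forall>i\<in>{1..3}. Lc S i \<noteq> 0" "\<forall>i\<in>{1..3}. b_condition S \<gamma> b i"
    and "\<forall>i\<in>{1..3}. (k i)\<^sup>2 < exp (- travel_weight S \<gamma> i) * Kbound S \<gamma> b i"
  shows "positive_definite (Mmat S \<gamma> b (diag3 k))"
  unfolding Mmat_diag3[OF assms(1)]
proof (intro positive_definite_diag3 ballI)
  fix i :: nat assume i: "i \<in> {1..3}"
  have opp: "b i * Lc S i < 0"
    using b_condition_imp_opposite_sign assms(2-4) i by blast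
  then have "- Lc S i * (rho_c S - rho_f S) / b i > 0"
    using assms(1) by (auto simp: mult_less_0_iff zero_less_divide_iff zero_less_mult_iff divide_less_0_iff)
  moreover have "Kbound S \<gamma> b i - exp (travel_weight S \<gamma> i) * (k i)\<^sup>2 > 0"
    using assms(5) i by (simp add: exp_minus field_simps)
  ultimately have "- Lc S i * (rho_c S - rho_f S) / b i
      * (Kbound S \<gamma> b i - exp (travel_weight S \<gamma> i) * (k i)\<^sup>2) > 0"
    by (rule mult_pos_pos)
  then show "Dentry S \<gamma> b k i > 0"
    using opp by (subst Dentry_eq_Kbound) auto
qed

section \<open>The bound near the limit case\<close>

text \<open>\<open>Kbound\<close> depends on \<open>b\<close> only through the products \<open>b l * Lc S l\<close>, which no longer involve
  \<open>Lc\<close> under this choice of \<open>b\<close>; the factor \<open>exp (- w i)\<close> of \<open>b i * Lc S i\<close> cancels the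
  \<open>exp (w i)\<close> of the inner sum, with \<open>w\<close> the travel weight.\<close>

lemma Kbound_scaled:
  assumes "\<gamma> > 0" "\<forall>i\<in>{1..3}. Lc S i \<noteq> 0" "i \<in> {1..3}"
    and b: "\<forall>i\<in>{1..3}. b i = t * (- \<gamma> * exp (- travel_weight S \<gamma> i) / (3 * Lc S i))"
  defines "s \<equiv> \<Sum>j\<in>{1..3}. exp (- travel_weight S \<gamma> j)"
  shows "Kbound S \<gamma> b i = 1 - t\<^sup>2 * (2/9 * (3 - s) * s)"
proof -
  let ?w = "travel_weight S \<gamma>"
  have bL: "b l * Lc S l = - t * \<gamma> * exp (- ?w l) / 3" if "l \<in> {1..3}" for l
    using that assms(2) b by simp
  have Y: "(\<Sum>j\<in>{1..3}. exp (?w i - ?w j)) = exp (?w i) * s"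
    unfolding s_def sum_distrib_left by (simp flip: exp_add)
  have "(\<Sum>l\<in>{1..3}. 2 * b l * Lc S l / \<gamma>\<^sup>2 * (exp (?w l) - 1) * Z)
      = (\<Sum>l\<in>{1..3}. - 2 * t / (3 * \<gamma>) * Z * (1 - exp (- ?w l)))" for Z
  proof (rule sum.cong)
    fix l :: nat assume l: "l \<in> {1..3}"
    have "2 * b l * Lc S l / \<gamma>\<^sup>2 * (exp (?w l) - 1) * Z
        = 2 * (b l * Lc S l) / \<gamma>\<^sup>2 * (exp (?w l) - 1) * Z" by simp
    also have "\<dots> = - 2 * t / (3 * \<gamma>) * Z * (1 - exp (- ?w l))"
      unfolding bL[OF l] using assms(1)
      by (simp add: field_simps power2_eq_square flip: exp_add)
    finally show "2 * b l * Lc S l / \<gamma>\<^sup>2 * (exp (?w l) - 1) * Z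
        = - 2 * t / (3 * \<gamma>) * Z * (1 - exp (- ?w l))" .
  qed simp
  also have "\<dots> Z = - 2 * t / (3 * \<gamma>) * Z * (3 - s)" for Z
    unfolding sum_distrib_left[symmetric] s_def by (simp add: sum_subtractf)
  finally have "Kbound S \<gamma> b i
      = 1 - (b i * Lc S i) * (- 2 * t / (3 * \<gamma>) * (exp (?w i) * s) * (3 - s))"
    unfolding Kbound_def travel_weight_def[symmetric] Y by simp
  also have "\<dots> = 1 - t\<^sup>2 * (2/9 * (3 - s) * s)"
    unfolding bL[OF assms(3)] using assms(1)
    by (simp add: exp_minus field_simps power2_eq_square)
  finally show ?thesis .
qed

lemma Kbound_scaled_pos:
  assumes "\<gamma> > 0" "\<forall>i\<in>{1..3}. Lc S i \<noteq> 0" "i \<in> {1..3}"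
    and "\<forall>i\<in>{1..3}. b i = t * (- \<gamma> * exp (- travel_weight S \<gamma> i) / (3 * Lc S i))"
    and "t\<^sup>2 < 2"
  shows "Kbound S \<gamma> b i > 0"
proof -
  define s where "s = (\<Sum>j\<in>{1..3}. exp (- travel_weight S \<gamma> j))"
  \<comment> \<open>\<open>(3 - s) * s\<close> is largest at \<open>s = 3/2\<close>\<close>
  have "(2 * s - 3)\<^sup>2 \<ge> 0" by simp
  then have "2/9 * (3 - s) * s \<le> 1/2"
    by (simp add: power2_eq_square algebra_simps)
  then have "t\<^sup>2 * (2/9 * (3 - s) * s) \<le> t\<^sup>2 * (1/2)"
    by (rule mult_left_mono) simp
  then show ?thesis
    using Kbound_scaled[OF assms(1-4)] assms(5) unfolding s_def by linarith
qed

text \<open>The interval for \<open>b i\<close> has the limit value and \<open>1 / (1 - e)\<close> times that value as its end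
  points, where \<open>e = exp (- travel_weight S \<gamma> i)\<close>. A factor below \<open>1 + e\<close> stays inside because
  \<open>(1 + e) * (1 - e) < 1\<close>.\<close>

lemma b_condition_scaled:
  assumes "\<gamma> > 0" "travel_weight S \<gamma> i > 0" "1 < t" "t < 1 + exp (- travel_weight S \<gamma> i)"
    and b: "b i = t * (- \<gamma> * exp (- travel_weight S \<gamma> i) / (3 * Lc S i))"
  shows "b_condition S \<gamma> b i"
proof -
  define e where "e = exp (- travel_weight S \<gamma> i)"
  define c where "c = - \<gamma> * e / (3 * Lc S i)"
  have e: "0 < e" "e < 1" using assms(2) by (simp_all add: e_def)
  have "t * (1 - e) < (1 + e) * (1 - e)"
    using assms(4) e unfolding e_def[symmetric] by (intro mult_strict_right_mono) auto
  also have "\<dots> < 1" using e by (simp add: algebra_simps)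
  finally have t: "t < 1 / (1 - e)" using e by (simp add: field_simps)
  have c2: "- \<gamma> * e / (3 * Lc S i * (1 - e)) = c * (1 / (1 - e))"
    by (simp add: c_def)
  have "c < 0" if "Lc S i > 0" using that e assms(1) by (simp add: c_def)
  moreover have "c > 0" if "Lc S i < 0"
    unfolding c_def using that e assms(1) by (intro divide_neg_neg) simp_all
  moreover have "b i = c * t" using b by (simp add: c_def e_def)
  ultimately show ?thesis
    unfolding b_condition_def travel_weight_def[symmetric] e_def[symmetric] c2
    unfolding c_def[symmetric]
    using t assms(3) by (auto simp: mult_less_cancel_left simp del: times_divide_eq_right)
qed

section \<open>Realising prescribed feedback parameters\<close>

lemma jacobian_matrix_vector_mult:
  fixes J :: "real^'n^'m"
  shows "jacobian ((*v) J) (at x) = J"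
proof -
  have "((*v) J has_derivative (*v) J) (at x)"
    by (simp add: bounded_linear_imp_has_derivative matrix_vector_mul_bounded_linear)
  then have "frechet_derivative ((*v) J) (at x) = (*v) J"
    by (rule frechet_derivative_at[symmetric])
  then show ?thesis
    by (simp add: jacobian_def matrix_of_matrix_vector_mul)
qed

lemma C2_on_matrix_vector_mult:
  fixes J :: "real^'n^'m"
  shows "C2_on A ((*v) J)"
proof -
  have "((*v) J has_derivative blinfun_apply (Blinfun ((*v) J))) F" for F
    by (simp add: bounded_linear_Blinfun_apply matrix_vector_mul_bounded_linear
        bounded_linear_imp_has_derivative)
  moreover have "((\<lambda>_. Blinfun ((*v) J)) has_derivative
      blinfun_apply (0 :: (real^'n) \<Rightarrow>\<^sub>L ((real^'n) \<Rightarrow>\<^sub>L (real^'m)))) F" for F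
    by (simp add: zero_blinfun.rep_eq)
  ultimately show ?thesis
    unfolding C2_on_def
    by (intro exI[of _ "\<lambda>_. Blinfun ((*v) J)"] exI[of _ "\<lambda>_. 0"] conjI ballI continuous_on_const)
qed

text \<open>The derivative terms cancel in \<open>tlam S 1\<close> and \<open>tlam S 3\<close>, leaving \<open>z_f S / rho_f S\<close> and
  \<open>z_c S / rho_c S\<close>; \<open>tlam S 2\<close> exceeds \<open>tlam S 1\<close> by \<open>rho_f S * deriv (press S) (rho_f S)\<close>.\<close>

lemma shock_tlam_pos:
  assumes "shock_steady_state S"
  shows "tlam S 1 > 0" "tlam S 2 > tlam S 1" "tlam S 3 > 0" "tlam S 4 > 0"
proof -
  have "rho_f S > 0" "rho_c S > 0" "z_f S > 0" "z_c S > 0"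
    and "\<And>\<rho>. \<rho> > 0 \<Longrightarrow> deriv (press S) \<rho> > 0"
    using assms by (auto simp: shock_steady_state_def pressure_law_def)
  moreover have "lam S 4 > 0" "press S (rho_c S) \<ge> 0"
    using assms by (auto simp: shock_steady_state_def pressure_law_def)
  ultimately show "tlam S 1 > 0" "tlam S 2 > tlam S 1" "tlam S 3 > 0" "tlam S 4 > 0"
    by (simp_all add: tlam_def sg_def rho_at_def lam_def add_pos_pos)
qed

text \<open>The upper left block of \<open>K1\<close> is the inverse of the block with rows \<open>(1/a, 1/c)\<close> and
  \<open>(1, 1)\<close>, where \<open>a = tlam S 1\<close> and \<open>c = tlam S 2\<close>.\<close>

lemma invert_coupling_block:
  fixes a c x y :: real
  assumes "0 < a" "a < c"
  shows "a * c / (c - a) * (x / a + y / c) + - a / (c - a) * (x + y) = x"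
    and "- a * c / (c - a) * (x / a + y / c) + c / (c - a) * (x + y) = y"
proof -
  have ac: "a * c * (x / a + y / c) = c * x + a * y"
    using assms by (simp add: field_simps)
  have "a * c / (c - a) * (x / a + y / c) + - a / (c - a) * (x + y)
      = (a * c * (x / a + y / c) - a * (x + y)) / (c - a)"
    by (simp add: diff_divide_distrib)
  also have "\<dots> = x * (c - a) / (c - a)"
    unfolding ac by (simp add: algebra_simps)
  finally show "a * c / (c - a) * (x / a + y / c) + - a / (c - a) * (x + y) = x"
    using assms by simp
  have "- a * c / (c - a) * (x / a + y / c) + c / (c - a) * (x + y)
      = (c * (x + y) - a * c * (x / a + y / c)) / (c - a)"
    by (simp add: diff_divide_distrib)
  also have "\<dots> = y * (c - a) / (c - a)"
    unfolding ac by (simp add: algebra_simps)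
  finally show "- a * c / (c - a) * (x / a + y / c) + c / (c - a) * (x + y) = y"
    using assms by simp
qed

text \<open>The last row of \<open>K2\<close> vanishes, so a Jacobian whose only nonzero column is the last one yields
  \<open>K = 0\<close>; the vector of the \<open>b i\<close> is then the image of that column \<open>w\<close> under \<open>K1\<close>. As
  \<open>K1\<close> is invertible, \<open>w\<close> can be chosen to produce any prescribed \<open>b\<close>.\<close>

lemma feedback_realisation:
  assumes "shock_steady_state S"
  obtains G where "C2_on UNIV G" "G 0 = 0" "Kmat S G = diag3 (\<lambda>_. 0)"
    "\<forall>i\<in>{1..3}. bvec S G i = b i"
proof -
  let ?t = "tlam S"
  define w :: "real^3" where
    "w = vector [b 1 / ?t 1 + b 2 / ?t 2, b 1 + b 2, b 3 * (?t 3 + ?t 4) / ?t 3]"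
  define J :: "real^4^3" where "J = (\<chi> i j. if j = 4 then w $ i else 0)"
  note t = shock_tlam_pos[OF assms]
  have "J ** K2 S = 0"
  proof -
    have "K2 S $ 4 $ j = 0" for j
      by (rule exhaust_3[of j, THEN disjE]) (auto simp: K2_def vector_def)
    then show ?thesis
      by (simp add: vec_eq_iff matrix_matrix_mult_def J_def if_distrib if_distribR cong: if_cong)
  qed
  moreover have "diag3 (\<lambda>_. 0) = 0"
    by (simp add: diag3_def vec_eq_iff forall_3)
  ultimately have "Kmat S ((*v) J) = diag3 (\<lambda>_. 0)"
    unfolding Kmat_def jacobian_matrix_vector_mult
    by (simp flip: matrix_mul_assoc)
  moreover have w: "J *v vector [0, 0, 0, 1] = w"
    by (simp add: vec_eq_iff matrix_vector_mult_def J_def vector_def if_distrib if_distribR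
        cong: if_cong)
  moreover have "\<forall>i\<in>{1..3}. bvec S ((*v) J) i = b i"
  proof -
    have "?t 3 / (?t 3 + ?t 4) * (b 3 * (?t 3 + ?t 4) / ?t 3) = b 3"
      using t by simp
    then show ?thesis
      unfolding ball_1_3 bvec_def jacobian_matrix_vector_mult w
      using invert_coupling_block[OF t(1,2), of "b 1" "b 2"]
      by (simp add: matrix_vector_mult_def sum_3 K1_def w_def)
  qed
  ultimately show ?thesis
    using that[of "(*v) J"] by (simp add: C2_on_matrix_vector_mult)
qed

theorem mainTheorem2:
  fixes S :: shock_data and \<gamma> :: real
  assumes "shock_steady_state S" and "\<gamma> > 0"
  shows "(\<forall>(G :: real^4 \<Rightarrow> real^3) (k :: nat \<Rightarrow> real).
            C2_on UNIV G \<and> G 0 = 0 \<and> Kmat S G = diag3 k \<longrightarrow>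
            Mmat S \<gamma> (bvec S G) (Kmat S G) = diag3 (Dentry S \<gamma> (bvec S G) k) \<and>
            ((\<forall>i\<in>{1..3}. Lc S i \<noteq> 0) \<and>
             (\<forall>i\<in>{1..3}. b_condition S \<gamma> (bvec S G) i) \<and>
             (\<forall>i\<in>{1..3}. (k i)\<^sup>2 <
                exp (- (\<gamma> * xs S / (xw S i * lam S i))) * Kbound S \<gamma> (bvec S G) i) \<longrightarrow>
             positive_definite (Mmat S \<gamma> (bvec S G) (Kmat S G)))) \<and>
         ((\<forall>i\<in>{1..3}. Lc S i \<noteq> 0) \<longrightarrow>
            (\<forall>b :: nat \<Rightarrow> real.
               (\<forall>i\<in>{1..3}.
                  b i = - \<gamma> * exp (- (\<gamma> * xs S / (xw S i * lam S i))) / (3 * Lc S i)) \<longrightarrow>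
               (\<forall>i\<in>{1..3}. Kbound S \<gamma> b i > 0))) \<and>
         ((\<forall>i\<in>{1..3}. Lc S i \<noteq> 0) \<longrightarrow>
            (\<exists>(k :: nat \<Rightarrow> real) (G :: real^4 \<Rightarrow> real^3).
               C2_on UNIV G \<and> G 0 = 0 \<and> Kmat S G = diag3 k \<and>
               (\<forall>i\<in>{1..3}. b_condition S \<gamma> (bvec S G) i) \<and>
               positive_definite (Mmat S \<gamma> (bvec S G) (Kmat S G))))"
proof (intro conjI impI allI)
  note less = shock_rho_less[OF assms(1)]
  fix G :: "real^4 \<Rightarrow> real^3" and k
  assume "C2_on UNIV G \<and> G 0 = 0 \<and> Kmat S G = diag3 k"
  then have K: "Kmat S G = diag3 k" by simp
  show "Mmat S \<gamma> (bvec S G) (Kmat S G) = diag3 (Dentry S \<gamma> (bvec S G) k)"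
    unfolding K by (rule Mmat_diag3[OF less])
  assume "(\<forall>i\<in>{1..3}. Lc S i \<noteq> 0) \<and> (\<forall>i\<in>{1..3}. b_condition S \<gamma> (bvec S G) i) \<and>
    (\<forall>i\<in>{1..3}. (k i)\<^sup>2 <
       exp (- (\<gamma> * xs S / (xw S i * lam S i))) * Kbound S \<gamma> (bvec S G) i)"
  then show "positive_definite (Mmat S \<gamma> (bvec S G) (Kmat S G))"
    unfolding K using less assms(2)
    by (intro Mmat_positive_definite) (simp_all add: travel_weight_def)
next
  fix b
  assume "\<forall>i\<in>{1..3}. Lc S i \<noteq> 0"
    and "\<forall>i\<in>{1..3}. b i = - \<gamma> * exp (- (\<gamma> * xs S / (xw S i * lam S i))) / (3 * Lc S i)"
  then show "\<forall>i\<in>{1..3}. Kbound S \<gamma> b i > 0"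
    using Kbound_scaled_pos[OF assms(2), where t = 1] by (simp add: travel_weight_def)
next
  assume L: "\<forall>i\<in>{1..3}. Lc S i \<noteq> 0"
  define e where "e = (\<lambda>i. exp (- travel_weight S \<gamma> i))"
  \<comment> \<open>\<open>m < 1\<close> keeps the scaling factor \<open>t\<close> below \<open>5/4\<close>, hence its square below 2\<close>
  define m where "m = min (e 1) (min (e 2) (e 3))"
  define t where "t = 1 + m / 4"
  have e: "0 < e i" "e i < 1" if "i \<in> {1..3}" for i
    using travel_weight_pos[OF assms that] by (simp_all add: e_def)
  have m: "0 < m" "m < 1"
    using e(1)[of 1] e(1)[of 2] e(1)[of 3] e(2)[of 1] by (auto simp: m_def)
  have m_le: "\<forall>i\<in>{1..3}. m \<le> e i"
    unfolding ball_1_3 m_def by linarith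
  have t_less: "t < 1 + e i" if "i \<in> {1..3}" for i
    using bspec[OF m_le that] m unfolding t_def by linarith
  have "t\<^sup>2 \<le> (5/4)\<^sup>2"
    using m by (intro power_mono) (simp_all add: t_def)
  then have t2: "t\<^sup>2 < 2" by (simp add: power2_eq_square)
  define b where "b i = t * (- \<gamma> * exp (- travel_weight S \<gamma> i) / (3 * Lc S i))" for i
  obtain G where G: "C2_on UNIV G" "G 0 = 0" "Kmat S G = diag3 (\<lambda>_. 0)"
    and bvec: "\<forall>i\<in>{1..3}. bvec S G i = b i"
    using feedback_realisation[OF assms(1)] .
  have cond: "\<forall>i\<in>{1..3}. b_condition S \<gamma> (bvec S G) i"
  proof
    fix i :: nat assume i: "i \<in> {1..3}"
    have "1 < t" using m by (simp add: t_def)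
    then show "b_condition S \<gamma> (bvec S G) i"
      using travel_weight_pos[OF assms i] t_less[OF i] bvec i assms(2) unfolding e_def b_def
      by (intro b_condition_scaled[of \<gamma> S i t]) simp_all
  qed
  have "Kbound S \<gamma> (bvec S G) i > 0" if "i \<in> {1..3}" for i
    using Kbound_scaled_pos[OF assms(2) L that bvec[unfolded b_def] t2] .
  then have "positive_definite (Mmat S \<gamma> (bvec S G) (Kmat S G))"
    unfolding G(3) using shock_rho_less[OF assms(1)] assms(2) L cond
    by (intro Mmat_positive_definite) simp_all
  then show "\<exists>k (G :: real^4 \<Rightarrow> real^3).
      C2_on UNIV G \<and> G 0 = 0 \<and> Kmat S G = diag3 k \<and>
      (\<forall>i\<in>{1..3}. b_condition S \<gamma> (bvec S G) i) \<and>
      positive_definite (Mmat S \<gamma> (bvec S G) (Kmat S G))"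
    using G cond by (intro exI[of _ "\<lambda>_. 0"] exI[of _ G] conjI)
qed

end
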